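(* For all real $z$ with $0\le z<\sqrt2-1$, the function $\mathrm{Iso}$ defined in the context satisfies $$\mathrm{Iso}(z)^2=\frac{9\sqrt2}{8\pi}\cdot\frac{\left({}_2F_1\!\left(-\tfrac32,-\tfrac32;1;\tfrac{4z^2}{(1-z^2)^2}\right)\right)^2}{\left({}_2F_1\!\left(-\tfrac12,-\tfrac12;1;\tfrac{4z^2}{(1-z^2)^2}\right)\right)^3}\cdot\left(\frac{1-z^2}{1+z^2}\right)^3 .$$
   Context: The Gaussian hypergeometric function is ${}_2F_1(a,b;c;x)=\sum_{n\ge0}\frac{(a)_n(b)_n}{(c)_n}\frac{x^n}{n!}$, where $(a)_n=a(a+1)\cdots(a+n-1)$ and $(a)_0=1$. Let $\bar A(z)=4+52z+477z^2+3809z^3+\cdots$ be the unique power series with $\bar A(0)=4$ satisfying $$z(z-1)(z^2-6z+1)(z+1)^2\bar A''(z)+(z+1)(5z^4-8z^3-32z^2+28z-1)\bar A'(z)+(4z^4+11z^3-z^2-43z+13)\bar A(z)=0,$$ and let $\bar V(z)=2+48z+\frac{1269}{2}z^2+6600z^3+\cdots$ be the unique power series with $\bar V(0)=2$ satisfying $$z(z-1)(z+1)(z^2-6z+1)^2\bar V''(z)+(z^2-6z+1)(7z^4-22z^3-18z^2+26z-1)\bar V'(z)+3(3z^5-24z^4-2z^3+56z^2-25z+8)\bar V(z)=0.$$ Both series converge for $|z|<3-2\sqrt2=(\sqrt2-1)^2$. For $|z|<\sqrt2-1$ put $$A(z)=\sqrt2\,\pi^2\,\bar A(z^2),\qquad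 V(z)=\sqrt2\,\pi^2\,\bar V(z^2).$$ The function $\mathrm{Iso}$ is defined for $z\in[0,\sqrt2-1)$ by $\mathrm{Iso}(z)=6\sqrt\pi\,\dfrac{V(z)}{A(z)^{3/2}}$. *)

theory Defs
  imports "HOL-Analysis.Analysis"
begin

definition hyp2F1 :: "real \<Rightarrow> real \<Rightarrow> real \<Rightarrow> real \<Rightarrow> real" where
  "hyp2F1 a b c x = eval_fps (fps_hypergeo [a, b] [c] 1) x"

lemma hyp2F1_eq_suminf:
  "hyp2F1 a b c x =
     (\<Sum>n. pochhammer a n * pochhammer b n / pochhammer c n * (x ^ n / fact n))"
  by (simp add: hyp2F1_def eval_fps_def)

definition solves_A_ode :: "real fps \<Rightarrow> bool" where
  "solves_A_ode F \<longleftrightarrow>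
     fps_X * (fps_X - 1) * (fps_X^2 - 6 * fps_X + 1) * (fps_X + 1)^2 * fps_deriv (fps_deriv F)
     + (fps_X + 1) * (5 * fps_X^4 - 8 * fps_X^3 - 32 * fps_X^2 + 28 * fps_X - 1) * fps_deriv F
     + (4 * fps_X^4 + 11 * fps_X^3 - fps_X^2 - 43 * fps_X + 13) * F = 0"

definition solves_V_ode :: "real fps \<Rightarrow> bool" where
  "solves_V_ode F \<longleftrightarrow>
     fps_X * (fps_X - 1) * (fps_X + 1) * (fps_X^2 - 6 * fps_X + 1)^2 * fps_deriv (fps_deriv F)
     + (fps_X^2 - 6 * fps_X + 1) * (7 * fps_X^4 - 22 * fps_X^3 - 18 * fps_X^2 + 26 * fps_X - 1)
         * fps_deriv F
     + 3 * (3 * fps_X^5 - 24 * fps_X^4 - 2 * fps_X^3 + 56 * fps_X^2 - 25 * fps_X + 8) * F = 0"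

definition Abar :: "real fps" where
  "Abar = (THE F. fps_nth F 0 = 4 \<and> solves_A_ode F)"

definition Vbar :: "real fps" where
  "Vbar = (THE F. fps_nth F 0 = 2 \<and> solves_V_ode F)"

text \<open>
  Both equations have a regular singular point at the origin with double exponent zero, so a
  formal power series solution is determined by its constant coefficient. This shows that the
  two definite descriptions above are proper.
\<close>

lemma fps_ode_ex1:
  fixes P Q R :: "real fps"
  assumes P0: "fps_nth P 0 = -1" and Q0: "fps_nth Q 0 = -1"
  shows "\<exists>!F. fps_nth F 0 = c \<and>
    fps_X * P * fps_deriv (fps_deriv F) + Q * fps_deriv F + R * F = 0"
proof -
  define S where "S f n =
     (\<Sum>i=1..n. fps_nth P i * (real (n-i) * (real (n-i+1) * f (n-i+1))))
     + (\<Sum>i=1..n. fps_nth Q i * (real (n-i+1) * f (n-i+1)))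
     + (\<Sum>i=0..n. fps_nth R i * f (n-i))" for f :: "nat \<Rightarrow> real" and n
  have S_cong: "S f n = S g n" if "\<And>k. k \<le> n \<Longrightarrow> f k = g k" for f g n
    unfolding S_def by (intro arg_cong2[where f="(+)"] sum.cong refl) (auto simp: that)
  have X: "fps_nth (fps_X * fps_deriv (fps_deriv F)) k = real k * (real (k+1) * fps_nth F (k+1))"
    for F :: "real fps" and k
    by (cases k) (simp_all add: algebra_simps)
  have nth: "fps_nth (fps_X * P * fps_deriv (fps_deriv F) + Q * fps_deriv F + R * F) n
      = S (fps_nth F) n - (real n + 1)^2 * fps_nth F (Suc n)" for F n
  proof -
    have "fps_X * P * fps_deriv (fps_deriv F) = P * (fps_X * fps_deriv (fps_deriv F))"
      by (simp add: mult_ac)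
    then have 1: "fps_nth (fps_X * P * fps_deriv (fps_deriv F)) n =
        (\<Sum>i=0..n. fps_nth P i * (real (n-i) * (real (n-i+1) * fps_nth F (n-i+1))))"
      by (simp only: fps_mult_nth[of P] X)
    have 2: "fps_nth (Q * fps_deriv F) n =
        (\<Sum>i=0..n. fps_nth Q i * (real (n-i+1) * fps_nth F (n-i+1)))"
      by (simp add: fps_mult_nth)
    have 3: "fps_nth (R * F) n = (\<Sum>i=0..n. fps_nth R i * fps_nth F (n-i))"
      by (simp add: fps_mult_nth)
    have split: "(\<Sum>i=0..n. h i) = h 0 + (\<Sum>i=1..n. h i)" for h :: "nat \<Rightarrow> real"
      by (simp add: sum.atLeast_Suc_atMost)
    show ?thesis
      unfolding fps_add_nth 1 2 3 S_def
      by (subst (1 2) split) (simp add: P0 Q0 algebra_simps power2_eq_square)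
  qed
  have ode_iff: "fps_X * P * fps_deriv (fps_deriv F) + Q * fps_deriv F + R * F = 0 \<longleftrightarrow>
      (\<forall>n. fps_nth F (Suc n) = S (fps_nth F) n / (real n + 1)^2)" for F
  proof -
    have "real n + 1 \<noteq> 0" for n
      by linarith
    then show ?thesis
      unfolding fps_eq_iff nth by (auto simp: field_simps)
  qed
  have "\<exists>f. \<forall>n. f n = (case n of 0 \<Rightarrow> c | Suc m \<Rightarrow> S f m / (real m + 1)^2)"
    by (rule dependent_wellorder_choice)
       (auto split: nat.split simp: less_Suc_eq_le cong: S_cong intro!: arg_cong2[where f="(/)"] S_cong)
  then obtain f where f: "\<And>n. f n = (case n of 0 \<Rightarrow> c | Suc m \<Rightarrow> S f m / (real m + 1)^2)"
    by blast
  show ?thesis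
  proof (rule ex1I[of _ "Abs_fps f"])
    have "f 0 = c" "\<And>n. f (Suc n) = S f n / (real n + 1)^2"
      by (subst f, simp)+
    then show "fps_nth (Abs_fps f) 0 = c \<and> fps_X * P * fps_deriv (fps_deriv (Abs_fps f)) +
        Q * fps_deriv (Abs_fps f) + R * Abs_fps f = 0"
      unfolding ode_iff by (simp add: Abs_fps_inverse)
  next
    fix G assume "fps_nth G 0 = c \<and>
      fps_X * P * fps_deriv (fps_deriv G) + Q * fps_deriv G + R * G = 0"
    then have G: "fps_nth G 0 = c" "\<And>n. fps_nth G (Suc n) = S (fps_nth G) n / (real n + 1)^2"
      unfolding ode_iff by auto
    have "fps_nth G n = f n" for n
    proof (induction n rule: less_induct)
      case (less n)
      then show ?case
        by (subst f) (auto split: nat.split simp: G less_Suc_eq_le intro!: arg_cong2[where f="(/)"] S_cong)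
    qed
    then show "G = Abs_fps f"
      by (simp add: fps_eq_iff)
  qed
qed

lemma Abar_ex1: "\<exists>!F. fps_nth F 0 = 4 \<and> solves_A_ode F"
  using fps_ode_ex1[of "(fps_X - 1) * (fps_X^2 - 6 * fps_X + 1) * (fps_X + 1)^2"
      "(fps_X + 1) * (5 * fps_X^4 - 8 * fps_X^3 - 32 * fps_X^2 + 28 * fps_X - 1)" 4]
  unfolding solves_A_ode_def by (simp add: mult.assoc fps_nth_power_0)

lemma Vbar_ex1: "\<exists>!F. fps_nth F 0 = 2 \<and> solves_V_ode F"
  using fps_ode_ex1[of "(fps_X - 1) * (fps_X + 1) * (fps_X^2 - 6 * fps_X + 1)^2"
      "(fps_X^2 - 6 * fps_X + 1) * (7 * fps_X^4 - 22 * fps_X^3 - 18 * fps_X^2 + 26 * fps_X - 1)" 2]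
  unfolding solves_V_ode_def by (simp add: mult.assoc fps_nth_power_0)

definition A :: "real \<Rightarrow> real" where
  "A z = sqrt 2 * pi^2 * eval_fps Abar (z^2)"

definition V :: "real \<Rightarrow> real" where
  "V z = sqrt 2 * pi^2 * eval_fps Vbar (z^2)"

definition Iso :: "real \<Rightarrow> real" where
  "Iso z = 6 * sqrt pi * (V z / A z powr (3/2))"

end

theory Submission
  imports Defs
begin

text \<open>
  Put \<open>y = 4 w / (1 - w)\<^sup>2\<close>, so that \<open>1 - y = (w\<^sup>2 - 6 w + 1) / (1 - w)\<^sup>2\<close>. Pulling the hypergeometric
  equation back along \<open>y\<close> and twisting by a rational prefactor gives the two equations that define
  \<open>Abar\<close> and \<open>Vbar\<close>, whence, as formal power series,
  \<open>Abar = 4 (1 - w\<^sup>2) / (w\<^sup>2 - 6 w + 1)\<^sup>2 \<cdot> F(-1/2, -1/2; 1; y)\<close> and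
  \<open>Vbar = 2 (1 - w)\<^sup>3 / (w\<^sup>2 - 6 w + 1)\<^sup>3 \<cdot> F(-3/2, -3/2; 1; y)\<close>.
  The prefactors are rewritten as \<open>4 (1 + w) / (1 - w)\<^sup>3 \<cdot> (1 - y)\<^sup>-\<^sup>2\<close> and \<open>2 / (1 - w)\<^sup>3 \<cdot> (1 - y)\<^sup>-\<^sup>3\<close>.
  Every series composed with \<open>y\<close> then has nonnegative coefficients, so Tonelli's theorem turns the
  formal composition into a composition of functions on \<open>0 \<le> w < 3 - 2 \<surd>2\<close>, where \<open>y < 1\<close>.
\<close>

section \<open>The hypergeometric series with lower parameter 1: recurrence, equation, radius,
  sign\<close>

lemma fps_hypergeo_2_1_Suc:
  fixes a b :: real
  shows "fps_nth (fps_hypergeo [a, b] [1] 1) (Suc n)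
    = (a + real n) * (b + real n) / (real n + 1)^2 * fps_nth (fps_hypergeo [a, b] [1] 1) n"
  unfolding fps_hypergeo_rec by (simp add: power2_eq_square add.commute del: fps_hypergeo_nth)

text \<open>Comparing coefficients of \<open>X^n\<close> leaves exactly the recurrence
  \<open>(n+1)^2 h_(n+1) = (a+n) (b+n) h_n\<close>.\<close>

lemma fps_hypergeo_2_1_ode:
  fixes a b :: real
  defines "H \<equiv> fps_hypergeo [a, b] [1] 1"
  shows "fps_X * (1 - fps_X) * fps_deriv (fps_deriv H)
           + (1 - fps_const (a + b + 1) * fps_X) * fps_deriv H - fps_const (a * b) * H = 0"
proof (rule fps_ext)
  fix n
  have rec: "fps_nth H (Suc n) * (real n + 1)^2 = (a + real n) * (b + real n) * fps_nth H n" for n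
  proof -
    have "real n + 1 \<noteq> 0" by linarith
    then show ?thesis
      unfolding H_def fps_hypergeo_2_1_Suc by simp
  qed
  have X1: "fps_nth (fps_X * fps_deriv (fps_deriv H)) n = real n * (real n + 1) * fps_nth H (Suc n)"
    by (cases n) (simp_all add: algebra_simps)
  have X2: "fps_nth (fps_X * (fps_X * fps_deriv (fps_deriv H))) n = real n * (real n - 1) * fps_nth H n"
    by (cases n; cases "n - 1") (auto simp: algebra_simps)
  have X3: "fps_nth (fps_X * fps_deriv H) n = real n * fps_nth H n"
    by (cases n) auto
  have *: "fps_X * (1 - fps_X) * fps_deriv (fps_deriv H)
      + (1 - fps_const (a + b + 1) * fps_X) * fps_deriv H - fps_const (a * b) * H
      = fps_X * fps_deriv (fps_deriv H) - fps_X * (fps_X * fps_deriv (fps_deriv H))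
      + fps_deriv H - fps_const (a + b + 1) * (fps_X * fps_deriv H) - fps_const (a * b) * H"
    by (simp add: algebra_simps)
  show "fps_nth (fps_X * (1 - fps_X) * fps_deriv (fps_deriv H)
      + (1 - fps_const (a + b + 1) * fps_X) * fps_deriv H - fps_const (a * b) * H) n = fps_nth 0 n"
    unfolding * fps_add_nth fps_sub_nth X1 X2 fps_mult_left_const_nth X3 fps_deriv_nth
    using rec[of n] by (simp add: algebra_simps power2_eq_square)
qed

text \<open>Ratio test. The hypotheses keep every coefficient nonzero; a parameter in {0, -1, -2,
  ...} would make the series a polynomial, of infinite radius.\<close>

lemma fps_hypergeo_conv_radius:
  fixes a b :: real
  assumes "\<And>n. a + real n \<noteq> 0" "\<And>n. b + real n \<noteq> 0"
  shows "fps_conv_radius (fps_hypergeo [a, b] [1] 1) = 1"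
proof -
  define H where "H = fps_hypergeo [a, b] [1] 1"
  have rec: "fps_nth H (Suc n) = (a + real n) * (b + real n) / (real n + 1)^2 * fps_nth H n" for n
    unfolding H_def by (rule fps_hypergeo_2_1_Suc)
  have pos: "real n + 1 \<noteq> 0" for n by linarith
  have nz: "fps_nth H n \<noteq> 0" for n
  proof (induction n)
    case 0
    then show ?case by (simp add: H_def)
  next
    case (Suc n)
    then show ?case using assms pos unfolding rec by simp
  qed
  \<comment> \<open>Uses \<open>(t+1) / (a+t) = 1 + (1-a) / (a+t)\<close>, a form in which the limit
    1 of the coefficient quotient is visible.\<close>
  have quot: "x / ((a + t) * (b + t) / (t + 1)^2 * x)
      = (1 + (1 - a) / (a + t)) * (1 + (1 - b) / (b + t))"
    if "x \<noteq> 0" "a + t \<noteq> 0" "b + t \<noteq> 0" "t + 1 \<noteq> 0" for x t :: real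
    using that by (simp add: divide_simps) algebra
  have "(\<lambda>n. norm (fps_nth H n) / norm (fps_nth H (Suc n)))
      = (\<lambda>n. \<bar>1 + (1 - a) / (a + real n)\<bar> * \<bar>1 + (1 - b) / (b + real n)\<bar>)"
  proof
    fix n
    show "norm (fps_nth H n) / norm (fps_nth H (Suc n)) = \<bar>1 + (1 - a) / (a + real n)\<bar> * \<bar>1 + (1 - b) / (b + real n)\<bar>"
      using quot[OF nz[of n] assms(1)[of n] assms(2)[of n] pos[of n]]
      by (simp only: rec real_norm_def flip: abs_mult abs_divide)
  qed
  moreover have "(\<lambda>n. 1 + (1 - c) / (c + real n)) \<longlonglongrightarrow> 1 + 0" for c
    by (intro tendsto_intros tendsto_divide_0[OF tendsto_const] filterlim_at_top_imp_at_infinity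
        filterlim_tendsto_add_at_top[OF tendsto_const filterlim_real_sequentially])
  then have "(\<lambda>n. \<bar>1 + (1 - a) / (a + real n)\<bar> * \<bar>1 + (1 - b) / (b + real n)\<bar>) \<longlonglongrightarrow> \<bar>1 + 0\<bar> * \<bar>1 + 0\<bar>"
    by (intro tendsto_mult tendsto_rabs)
  ultimately have "(\<lambda>n. norm (fps_nth H n) / norm (fps_nth H (Suc n))) \<longlonglongrightarrow> 1"
    by simp
  then show ?thesis
    using conv_radius_ratio_limit_nonzero[of 1 1 "fps_nth H"] nz
    by (simp add: fps_conv_radius_def H_def)
qed

text \<open>With equal upper parameters the factor in the recurrence is a square over a square, even
  for negative \<open>a\<close>.\<close>

lemma fps_hypergeo_square_nonneg:
  fixes a :: real
  shows "fps_nth (fps_hypergeo [a, a] [1] 1) n \<ge> 0"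
  by (induction n) (simp_all add: fps_hypergeo_2_1_Suc del: fps_hypergeo_nth)

section \<open>Composition of power series with nonnegative coefficients\<close>

lemma fps_power_nth_nonneg:
  fixes f :: "'a :: linordered_idom fps"
  assumes "\<And>n. fps_nth f n \<ge> 0"
  shows "fps_nth (f ^ i) n \<ge> 0"
  using assms by (induction i arbitrary: n) (auto simp: fps_mult_nth intro!: sum_nonneg mult_nonneg_nonneg)

text \<open>The double family \<open>f_i [g^i]_n w^n\<close> is summed in both orders. Summing over
  \<open>n\<close> first gives \<open>f_i g(w)^i\<close> and then \<open>f(g(w))\<close>; summing
  over \<open>i\<close> first gives the terms of the series of \<open>f oo g\<close>.\<close>

lemma sums_fps_compose_nonneg:
  fixes f g :: "real fps"
  assumes f: "\<And>n. fps_nth f n \<ge> 0" and g: "\<And>n. fps_nth g n \<ge> 0"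
    and g0: "fps_nth g 0 = 0" and w: "0 \<le> w" "ereal w < fps_conv_radius g"
    and r: "ereal (eval_fps g w) < fps_conv_radius f"
  shows "(\<lambda>n. fps_nth (f oo g) n * w ^ n) sums eval_fps f (eval_fps g w)"
proof -
  define a where "a = (\<lambda>(i, n). fps_nth f i * (fps_nth (g ^ i) n * w ^ n))"
  have nw: "ereal (norm w) < fps_conv_radius g"
    using w by simp
  have gw: "eval_fps g w \<ge> 0"
    unfolding eval_fps_def using g w summable_fps[OF nw] by (intro suminf_nonneg) auto
  have gi: "fps_nth (g ^ i) n \<ge> 0" for i n
    by (rule fps_power_nth_nonneg[OF g])
  have a_nonneg: "a x \<ge> 0" for x
    using f gi w by (simp add: a_def split: prod.split)
  have inner: "((\<lambda>n. a (i, n)) has_sum (fps_nth f i * eval_fps g w ^ i)) UNIV" for i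
  proof (rule sums_nonneg_imp_has_sum)
    have "ereal (norm w) < fps_conv_radius (g ^ i)"
      using nw fps_conv_radius_power[of g i] by (rule less_le_trans)
    then show "(\<lambda>n. a (i, n)) sums (fps_nth f i * eval_fps g w ^ i)"
      unfolding a_def prod.case eval_fps_power[OF nw, symmetric]
      by (intro sums_mult sums_eval_fps)
  qed (rule a_nonneg)
  have outer: "((\<lambda>i. fps_nth f i * eval_fps g w ^ i) has_sum eval_fps f (eval_fps g w)) UNIV"
    using r gw f by (intro sums_nonneg_imp_has_sum sums_eval_fps mult_nonneg_nonneg) auto
  \<comment> \<open>All terms being nonnegative, summability of the iterated sums already gives
    joint summability.\<close>
  have "(a has_sum eval_fps f (eval_fps g w)) (UNIV \<times> UNIV)"
    using summable_on_SigmaI[OF inner has_sum_imp_summable[OF outer] a_nonneg]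
    by (intro has_sum_SigmaI[OF inner outer]) auto
  then have swap: "((\<lambda>(n, i). a (i, n)) has_sum eval_fps f (eval_fps g w)) (UNIV \<times> UNIV)"
    using has_sum_swap by blast
  have "((\<lambda>i. a (i, n)) has_sum (fps_nth (f oo g) n * w ^ n)) UNIV" for n
  proof -
    \<comment> \<open>Since \<open>g\<close> has no constant term, \<open>g^i\<close> starts at
      degree \<open>i\<close> or later, so the sum over \<open>i\<close> is the finite sum defining
      the coefficient of \<open>f oo g\<close>.\<close>
    have "a (i, n) = 0" if "i > n" for i
      using startsby_zero_power_prefix[OF g0, of i] that by (simp add: a_def)
    then have "((\<lambda>i. a (i, n)) has_sum (\<Sum>i=0..n. a (i, n))) UNIV"
      by (intro has_sum_finite_neutralI) auto
    then show ?thesis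
      by (simp add: fps_compose_nth a_def sum_distrib_right mult.assoc)
  qed
  then have "((\<lambda>n. fps_nth (f oo g) n * w ^ n) has_sum eval_fps f (eval_fps g w)) UNIV"
    using has_sum_SigmaD[OF swap] by simp
  then show ?thesis
    by (rule has_sum_imp_sums)
qed

subsection \<open>Pullback of the hypergeometric equation\<close>

text \<open>This is \<open>y\<close> as a formal series, four times the Koebe function. Writing it
  with \<open>inverse (1 - fps_X)\<close> makes the signs of its coefficients evident.\<close>

definition pullback_arg :: "real fps" where
  "pullback_arg = 4 * fps_X * inverse (1 - fps_X) ^ 2"

lemma pullback_arg_0: "fps_nth pullback_arg 0 = 0"
  by (simp add: pullback_arg_def)

lemma pullback_arg_eq: "(1 - fps_X) ^ 2 * pullback_arg = 4 * fps_X"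
proof -
  have "(1 - fps_X) * inverse (1 - fps_X :: real fps) = 1"
    by (simp add: inverse_mult_eq_1')
  then show ?thesis
    unfolding pullback_arg_def by algebra
qed

text \<open>Differentiate the relation with cleared denominators, multiply by \<open>1 - X\<close>,
  and replace \<open>(1-X)^2 y\<close> by \<open>4 X\<close>: the right-hand side becomes
  \<open>4 (1-X) + 8 X\<close>.\<close>

lemma pullback_arg_deriv: "(1 - fps_X) ^ 3 * fps_deriv pullback_arg = 4 * (1 + fps_X)"
proof -
  have "fps_deriv ((1 - fps_X) ^ 2 * pullback_arg) = fps_deriv (4 * fps_X)"
    by (simp only: pullback_arg_eq)
  then have "(1 - fps_X) ^ 2 * fps_deriv pullback_arg - 2 * (1 - fps_X) * pullback_arg = 4"
    by (simp add: fps_deriv_power' algebra_simps)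
  with pullback_arg_eq show ?thesis
    by algebra
qed

lemma one_minus_X_nonzero: "(1 - fps_X :: real fps) \<noteq> 0"
  by (metis diff_eq_diff_eq diff_self fps_X_neq_one)

lemma quadratic_nonzero: "(fps_X^2 - 6 * fps_X + 1 :: real fps) \<noteq> 0"
proof
  assume "(fps_X^2 - 6 * fps_X + 1 :: real fps) = 0"
  then have "fps_nth (fps_X^2 - 6 * fps_X + 1 :: real fps) 0 = 0"
    by (simp only: fps_zero_nth)
  then show False
    by (simp add: fps_nth_power_0)
qed

text \<open>By the chain rule, the first two derivatives of \<open>H\<close> composed with
  \<open>y\<close> are expressible through those of \<open>G\<close>. All relations are kept free of
  denominators, as polynomial identities over the ring of formal series.\<close>

lemma pullback_ode:
  fixes H :: "real fps"
  assumes H: "fps_X * (1 - fps_X) * fps_deriv (fps_deriv H)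
           + (1 - fps_const c * fps_X) * fps_deriv H - fps_const d * H = 0"
  defines "G \<equiv> H oo pullback_arg"
  shows "fps_X * (fps_X^2 - 6 * fps_X + 1) * (1 - fps_X)^2 * (1 + fps_X) * fps_deriv (fps_deriv G)
    - (3 * fps_X * (fps_X^2 - 6 * fps_X + 1) * (1 - fps_X) * (1 + fps_X)
       + fps_X * (fps_X^2 - 6 * fps_X + 1) * (1 - fps_X)^2
       - (1 + fps_X)^2 * (1 - fps_X) * ((1 - fps_X)^2 - fps_const c * (4 * fps_X))) * fps_deriv G
    - 4 * fps_const d * (1 + fps_X)^3 * G = 0"
proof -
  define y where "y = pullback_arg"
  define G1 where "G1 = fps_deriv H oo y"
  define G2 where "G2 = fps_deriv (fps_deriv H) oo y"
  note [simp] = pullback_arg_0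
  have G': "fps_deriv G = G1 * fps_deriv y"
    by (simp add: G_def G1_def y_def fps_compose_deriv)
  have G1': "fps_deriv G1 = G2 * fps_deriv y"
    by (simp add: G2_def G1_def y_def fps_compose_deriv)
  have y: "(1 - fps_X)^2 * y = 4 * fps_X"
    unfolding y_def by (rule pullback_arg_eq)
  have y': "(1 - fps_X)^3 * fps_deriv y = 4 * (1 + fps_X)"
    unfolding y_def by (rule pullback_arg_deriv)
  have H': "y * (1 - y) * G2 + (1 - fps_const c * y) * G1 - fps_const d * G = 0"
    using arg_cong[OF H, of "\<lambda>F. F oo y"]
    by (simp add: G_def G1_def G2_def y_def fps_compose_mult_distrib fps_compose_add_distrib
        fps_compose_sub_distrib)
  have e1: "(1 - fps_X)^3 * fps_deriv G = 4 * (1 + fps_X) * G1"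
    using G' y' by algebra
  have "fps_deriv ((1 - fps_X)^3 * fps_deriv G) = fps_deriv (4 * (1 + fps_X) * G1)"
    by (simp only: e1)
  then have e2: "(1 - fps_X)^3 * fps_deriv (fps_deriv G) - 3 * (1 - fps_X)^2 * fps_deriv G
      = 4 * G1 + 4 * (1 + fps_X) * G2 * fps_deriv y"
    by (simp add: fps_deriv_power' G1' algebra_simps)
  have e3: "(1 - fps_X)^6 * fps_deriv (fps_deriv G) - 3 * (1 - fps_X)^5 * fps_deriv G
      = 4 * (1 - fps_X)^3 * G1 + 16 * (1 + fps_X)^2 * G2"
    using e2 y' by algebra
  \<comment> \<open>The composed equation times \<open>(1-X)^4\<close>, where
    \<open>(1-X)^2 (1-y) = X^2 - 6 X + 1\<close>.\<close>
  have H'': "4 * fps_X * (fps_X^2 - 6 * fps_X + 1) * G2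
      + (1 - fps_X)^2 * ((1 - fps_X)^2 - fps_const c * (4 * fps_X)) * G1
      - (1 - fps_X)^4 * fps_const d * G = 0"
    using H' y by algebra
  let ?L = "fps_X * (fps_X^2 - 6 * fps_X + 1) * (1 - fps_X)^2 * (1 + fps_X) * fps_deriv (fps_deriv G)
    - (3 * fps_X * (fps_X^2 - 6 * fps_X + 1) * (1 - fps_X) * (1 + fps_X)
       + fps_X * (fps_X^2 - 6 * fps_X + 1) * (1 - fps_X)^2
       - (1 + fps_X)^2 * (1 - fps_X) * ((1 - fps_X)^2 - fps_const c * (4 * fps_X))) * fps_deriv G
    - 4 * fps_const d * (1 + fps_X)^3 * G"
  \<comment> \<open>\<open>e1\<close> and \<open>e3\<close> eliminate \<open>G1\<close> and
    \<open>G2\<close> from \<open>H''\<close>; the surplus power of \<open>1 - X\<close> is then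
    cancelled in an integral domain.\<close>
  have "(1 - fps_X)^4 * ?L = 0"
    using e1 e3 H'' by algebra
  then show ?thesis
    using one_minus_X_nonzero by simp
qed

section \<open>Identification of \<open>Abar\<close> and \<open>Vbar\<close> as twisted
  pullbacks\<close>

lemma Abar_eqI: "solves_A_ode F \<Longrightarrow> fps_nth F 0 = 4 \<Longrightarrow> Abar = F"
  unfolding Abar_def using Abar_ex1 by (auto intro!: the1_equality)

lemma Vbar_eqI: "solves_V_ode F \<Longrightarrow> fps_nth F 0 = 2 \<Longrightarrow> Vbar = F"
  unfolding Vbar_def using Vbar_ex1 by (auto intro!: the1_equality)

text \<open>Differentiating the relation between \<open>F\<close> and \<open>H\<close> twice
  expresses \<open>F\<close>, \<open>F'\<close>, \<open>F''\<close>, up to powers of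
  \<open>?D\<close>, through \<open>H\<close>, \<open>H'\<close>, \<open>H''\<close>. The equation
  for \<open>F\<close> then follows from the pulled-back equation for \<open>H\<close>.\<close>

lemma solves_A_odeI:
  fixes H :: "real fps"
  defines "H \<equiv> fps_hypergeo [-1/2, -1/2] [1] 1 oo pullback_arg"
  assumes F: "(fps_X^2 - 6 * fps_X + 1)^2 * F = 4 * (1 - fps_X^2) * H"
  shows "solves_A_ode F"
proof -
  let ?D = "fps_X^2 - 6 * fps_X + 1 :: real fps"
  let ?p = "1 - fps_X^2 :: real fps"
  \<comment> \<open>For \<open>a = b = -1/2\<close> the parameters of \<open>pullback_ode\<close>
    are \<open>c = 0\<close> and \<open>d = 1/4\<close>.\<close>
  have ode: "fps_X * (fps_X^2 - 6 * fps_X + 1) * (1 - fps_X)^2 * (1 + fps_X) * fps_deriv (fps_deriv H)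
    - (3 * fps_X * (fps_X^2 - 6 * fps_X + 1) * (1 - fps_X) * (1 + fps_X)
       + fps_X * (fps_X^2 - 6 * fps_X + 1) * (1 - fps_X)^2
       - (1 + fps_X)^2 * (1 - fps_X) ^ 3) * fps_deriv H
    - (1 + fps_X)^3 * H = 0"
    using pullback_ode[OF fps_hypergeo_2_1_ode[of "-1/2" "-1/2"], folded H_def]
    by (simp add: numeral_fps_const power2_eq_square power3_eq_cube mult_ac)
  have "fps_deriv (?D^2 * F) = fps_deriv (4 * ?p * H)"
    by (simp only: F)
  then have F1: "?D^2 * fps_deriv F + 2 * ?D * (2 * fps_X - 6) * F
      = 4 * ?p * fps_deriv H - 8 * fps_X * H"
    by (simp add: fps_deriv_power' algebra_simps)
  then have "fps_deriv (?D^2 * fps_deriv F + 2 * ?D * (2 * fps_X - 6) * F)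
      = fps_deriv (4 * ?p * fps_deriv H - 8 * fps_X * H)"
    by (simp only: F1)
  then have F2: "?D^2 * fps_deriv (fps_deriv F) + 4 * ?D * (2 * fps_X - 6) * fps_deriv F
      + (2 * (2 * fps_X - 6)^2 + 4 * ?D) * F
      = 4 * ?p * fps_deriv (fps_deriv H) - 16 * fps_X * fps_deriv H - 8 * H"
    by (simp add: fps_deriv_power' algebra_simps power2_eq_square)
  \<comment> \<open>\<open>R1\<close> and \<open>R2\<close> are \<open>?D^3 F'\<close> and
    \<open>?D^4 F''\<close> written in terms of \<open>H\<close> alone; the factor
    \<open>2 * fps_X - 6\<close> is the derivative of \<open>?D\<close>.\<close>
  define R1 where "R1 = ?D * (4 * ?p * fps_deriv H - 8 * fps_X * H) - 8 * (2 * fps_X - 6) * ?p * H"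
  define R2 where "R2 = ?D^2 * (4 * ?p * fps_deriv (fps_deriv H) - 16 * fps_X * fps_deriv H - 8 * H)
    - 4 * (2 * fps_X - 6) * R1 - (2 * (2 * fps_X - 6)^2 + 4 * ?D) * (4 * ?p * H)"
  have R1: "?D^3 * fps_deriv F = R1"
    using F F1 unfolding R1_def by algebra
  have R2: "?D^4 * fps_deriv (fps_deriv F) = R2"
    using F R1 F2 unfolding R2_def by algebra
  let ?L = "fps_X * (fps_X - 1) * ?D * (fps_X + 1)^2 * fps_deriv (fps_deriv F)
     + (fps_X + 1) * (5 * fps_X^4 - 8 * fps_X^3 - 32 * fps_X^2 + 28 * fps_X - 1) * fps_deriv F
     + (4 * fps_X^4 + 11 * fps_X^3 - fps_X^2 - 43 * fps_X + 13) * F"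
  have "?D^4 * ?L = fps_X * (fps_X - 1) * ?D * (fps_X + 1)^2 * R2
     + (fps_X + 1) * (5 * fps_X^4 - 8 * fps_X^3 - 32 * fps_X^2 + 28 * fps_X - 1) * ?D * R1
     + (4 * fps_X^4 + 11 * fps_X^3 - fps_X^2 - 43 * fps_X + 13) * ?D^2 * (4 * ?p * H)"
    using F R1 R2 by algebra
  also have "\<dots> = 0"
    using ode unfolding R1_def R2_def by algebra
  finally show ?thesis
    using quadratic_nonzero unfolding solves_A_ode_def by simp
qed

lemma solves_V_odeI:
  fixes H :: "real fps"
  defines "H \<equiv> fps_hypergeo [-3/2, -3/2] [1] 1 oo pullback_arg"
  assumes F: "(fps_X^2 - 6 * fps_X + 1)^3 * F = 2 * (1 - fps_X)^3 * H"
  shows "solves_V_ode F"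
proof -
  let ?D = "fps_X^2 - 6 * fps_X + 1 :: real fps"
  let ?m = "1 - fps_X :: real fps"
  \<comment> \<open>Here \<open>c = -2\<close> and \<open>d = 9/4\<close>, which produces the
    summand \<open>8 * fps_X\<close> and the factor 9.\<close>
  have ode: "fps_X * (fps_X^2 - 6 * fps_X + 1) * (1 - fps_X)^2 * (1 + fps_X) * fps_deriv (fps_deriv H)
    - (3 * fps_X * (fps_X^2 - 6 * fps_X + 1) * (1 - fps_X) * (1 + fps_X)
       + fps_X * (fps_X^2 - 6 * fps_X + 1) * (1 - fps_X)^2
       - (1 + fps_X)^2 * (1 - fps_X) * ((1 - fps_X)^2 + 8 * fps_X)) * fps_deriv H
    - 9 * (1 + fps_X)^3 * H = 0"
  proof -
    have "fps_const (-3/2 + -3/2 + 1) = (-2 :: real fps)" "4 * fps_const (-3/2 * (-3/2)) = (9 :: real fps)"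
      by (simp_all add: numeral_fps_const)
    then show ?thesis
      using pullback_ode[OF fps_hypergeo_2_1_ode[of "-3/2" "-3/2"], folded H_def] by algebra
  qed
  have "fps_deriv (?D^3 * F) = fps_deriv (2 * ?m^3 * H)"
    by (simp only: F)
  then have F1: "?D^3 * fps_deriv F + 3 * ?D^2 * (2 * fps_X - 6) * F
      = 2 * ?m^3 * fps_deriv H - 6 * ?m^2 * H"
    by (simp add: fps_deriv_power' algebra_simps)
  then have "fps_deriv (?D^3 * fps_deriv F + 3 * ?D^2 * (2 * fps_X - 6) * F)
      = fps_deriv (2 * ?m^3 * fps_deriv H - 6 * ?m^2 * H)"
    by (simp only: F1)
  then have F2: "?D^3 * fps_deriv (fps_deriv F) + 6 * ?D^2 * (2 * fps_X - 6) * fps_deriv F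
      + (6 * ?D * (2 * fps_X - 6)^2 + 6 * ?D^2) * F
      = 2 * ?m^3 * fps_deriv (fps_deriv H) - 12 * ?m^2 * fps_deriv H + 12 * ?m * H"
    by (simp add: fps_deriv_power' algebra_simps power2_eq_square)
  define R1 where "R1 = ?D * (2 * ?m^3 * fps_deriv H - 6 * ?m^2 * H) - 6 * (2 * fps_X - 6) * ?m^3 * H"
  define R2 where "R2 = ?D^2 * (2 * ?m^3 * fps_deriv (fps_deriv H) - 12 * ?m^2 * fps_deriv H + 12 * ?m * H)
    - 6 * (2 * fps_X - 6) * R1 - (6 * (2 * fps_X - 6)^2 + 6 * ?D) * (2 * ?m^3 * H)"
  have R1: "?D^4 * fps_deriv F = R1"
    using F F1 unfolding R1_def by algebra
  have R2: "?D^5 * fps_deriv (fps_deriv F) = R2"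
    using F R1 F2 unfolding R2_def by algebra
  let ?L = "fps_X * (fps_X - 1) * (fps_X + 1) * ?D^2 * fps_deriv (fps_deriv F)
     + ?D * (7 * fps_X^4 - 22 * fps_X^3 - 18 * fps_X^2 + 26 * fps_X - 1) * fps_deriv F
     + 3 * (3 * fps_X^5 - 24 * fps_X^4 - 2 * fps_X^3 + 56 * fps_X^2 - 25 * fps_X + 8) * F"
  have "?D^5 * ?L = fps_X * (fps_X - 1) * (fps_X + 1) * ?D^2 * R2
     + ?D * (7 * fps_X^4 - 22 * fps_X^3 - 18 * fps_X^2 + 26 * fps_X - 1) * ?D * R1
     + 3 * (3 * fps_X^5 - 24 * fps_X^4 - 2 * fps_X^3 + 56 * fps_X^2 - 25 * fps_X + 8)
       * ?D^2 * (2 * ?m^3 * H)"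
    using F R1 R2 by algebra
  also have "\<dots> = 0"
    using ode unfolding R1_def R2_def by algebra
  finally show ?thesis
    using quadratic_nonzero unfolding solves_V_ode_def by simp
qed

text \<open>Composing \<open>1 / (1-X)\<close> with \<open>y\<close> gives
  \<open>1 / (1-y) = (1-X)^2 / (X^2 - 6 X + 1)\<close>. So the denominator of the prefactor can be
  absorbed into the composed series, where it appears with nonnegative coefficients.\<close>

lemma pullback_prefactor:
  fixes H :: "real fps"
  defines "u \<equiv> inverse (1 - fps_X :: real fps)"
  shows "(fps_X^2 - 6 * fps_X + 1)^k * ((H * u^k) oo pullback_arg)
    = (1 - fps_X)^(2 * k) * (H oo pullback_arg)"
proof -
  note [simp] = pullback_arg_0
  have "(1 - fps_X) * u = 1"
    by (simp add: u_def inverse_mult_eq_1')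
  then have "((1 - fps_X) * u) oo pullback_arg = 1"
    by simp
  then have *: "(1 - pullback_arg) * (u oo pullback_arg) = 1"
    by (simp add: fps_compose_mult_distrib fps_compose_sub_distrib)
  have "(fps_X^2 - 6 * fps_X + 1) * (u oo pullback_arg) = (1 - fps_X)^2"
    using * pullback_arg_eq by algebra
  then have "(fps_X^2 - 6 * fps_X + 1)^k * (u oo pullback_arg)^k = (1 - fps_X)^(2 * k)"
    by (simp add: power_mult flip: power_mult_distrib)
  then show ?thesis
    by (simp add: fps_compose_mult_distrib mult.assoc mult.left_commute[of _ "H oo _"]
        flip: fps_compose_power)
qed

lemma Abar_eq:
  "Abar = 4 * (1 + fps_X) * inverse (1 - fps_X)^3
     * ((fps_hypergeo [-1/2, -1/2] [1] 1 * inverse (1 - fps_X)^2) oo pullback_arg)"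
proof (rule Abar_eqI[OF solves_A_odeI])
  \<comment> \<open>\<open>pullback_prefactor\<close> yields \<open>(1-X)^4\<close>; the outer
    inverse cancels three of these factors and \<open>(1+X) (1-X) = 1 - X^2\<close> remains.\<close>
  have "(1 - fps_X) * inverse (1 - fps_X :: real fps) = 1"
    by (simp add: inverse_mult_eq_1')
  with pullback_prefactor[of 2 "fps_hypergeo [-1/2, -1/2] [1] 1"]
  show "(fps_X^2 - 6 * fps_X + 1)^2 * (4 * (1 + fps_X) * inverse (1 - fps_X)^3
     * ((fps_hypergeo [-1/2, -1/2] [1] 1 * inverse (1 - fps_X)^2) oo pullback_arg))
     = 4 * (1 - fps_X\<^sup>2) * (fps_hypergeo [- 1 / 2, - 1 / 2] [1] 1 oo pullback_arg)"
    by (simp only: mult_2 numeral_Bit0 [symmetric]) algebra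
qed (simp add: fps_nth_power_0)

lemma Vbar_eq:
  "Vbar = 2 * inverse (1 - fps_X)^3
     * ((fps_hypergeo [-3/2, -3/2] [1] 1 * inverse (1 - fps_X)^3) oo pullback_arg)"
proof (rule Vbar_eqI[OF solves_V_odeI])
  have "(1 - fps_X) * inverse (1 - fps_X :: real fps) = 1"
    by (simp add: inverse_mult_eq_1')
  with pullback_prefactor[of 3 "fps_hypergeo [-3/2, -3/2] [1] 1"]
  show "(fps_X^2 - 6 * fps_X + 1)^3 * (2 * inverse (1 - fps_X)^3
     * ((fps_hypergeo [-3/2, -3/2] [1] 1 * inverse (1 - fps_X)^3) oo pullback_arg))
     = 2 * (1 - fps_X)^3 * (fps_hypergeo [- 3 / 2, - 3 / 2] [1] 1 oo pullback_arg)"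
    by simp algebra
qed (simp add: fps_nth_power_0)

subsection \<open>Evaluation of the series\<close>

lemma inverse_one_minus_X_nth: "fps_nth (inverse (1 - fps_X :: real fps)) n = 1"
  by (simp add: fps_inverse_one_minus_fps_X)

lemma
  shows inverse_one_minus_X_conv_radius: "fps_conv_radius (inverse (1 - fps_X) :: real fps) = 1"
    and eval_inverse_one_minus_X: "\<bar>x\<bar> < 1 \<Longrightarrow> eval_fps (inverse (1 - fps_X)) x = 1 / (1 - x :: real)"
proof -
  show "fps_conv_radius (inverse (1 - fps_X) :: real fps) = 1"
    unfolding fps_conv_radius_def inverse_one_minus_X_nth
    by (rule conv_radius_ratio_limit[where c = 1]) auto
  show "eval_fps (inverse (1 - fps_X)) x = 1 / (1 - x :: real)" if "\<bar>x\<bar> < 1"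
    unfolding eval_fps_def inverse_one_minus_X_nth using that suminf_geometric[of x] by simp
qed

lemma pullback_arg_less_1:
  fixes w :: real
  assumes "0 \<le> w" "w < 3 - 2 * sqrt 2"
  shows "4 * w / (1 - w)^2 < 1" "w < 1"
proof -
  have "sqrt 2 > 1"
    by simp
  with assms show "w < 1"
    by linarith
  \<comment> \<open>\<open>(3-w)^2 - 8 = w^2 - 6 w + 1\<close>, and \<open>3 - 2 sqrt 2\<close> is
    the smaller root of this quadratic.\<close>
  have "(3 - w)^2 > (2 * sqrt 2)^2"
    using assms by (intro power_strict_mono) auto
  then have "4 * w < (1 - w)^2"
    by (simp add: power2_eq_square algebra_simps)
  then show "4 * w / (1 - w)^2 < 1"
    using \<open>w < 1\<close> by simp
qed

lemma one_minus_X_power_eval: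
  fixes f :: "real fps"
  assumes x: "\<bar>x\<bar> < 1" and f: "fps_conv_radius f \<ge> 1"
  shows "fps_conv_radius (f * inverse (1 - fps_X)^k) \<ge> 1"
    and "eval_fps (f * inverse (1 - fps_X)^k) x = eval_fps f x / (1 - x)^k"
proof -
  let ?u = "inverse (1 - fps_X) :: real fps"
  have u: "fps_conv_radius (?u^k) \<ge> 1"
    using fps_conv_radius_power[of ?u k] by (simp add: inverse_one_minus_X_conv_radius)
  show "fps_conv_radius (f * ?u^k) \<ge> 1"
    using fps_conv_radius_mult[of f "?u^k"] f u by (meson min.boundedI order_trans)
  have x': "ereal (norm x) < 1"
    using x by simp
  show "eval_fps (f * ?u^k) x = eval_fps f x / (1 - x)^k"
    using less_le_trans[OF x' f] less_le_trans[OF x' u] x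
    by (simp add: eval_fps_mult eval_fps_power inverse_one_minus_X_conv_radius
        eval_inverse_one_minus_X power_divide)
qed

lemma pullback_arg_eval:
  assumes "\<bar>w\<bar> < 1"
  shows "fps_conv_radius pullback_arg \<ge> 1" "eval_fps pullback_arg w = 4 * w / (1 - w)^2"
proof -
  have 1: "fps_conv_radius (4 * fps_X :: real fps) = \<infinity>"
    by (metis ereal_infty_less_eq(1) fps_conv_radius_fps_X fps_conv_radius_mult fps_conv_radius_numeral min.idem)
  have 2: "eval_fps (4 * fps_X) w = 4 * w"
    by (simp add: eval_fps_mult)
  show "fps_conv_radius pullback_arg \<ge> 1" "eval_fps pullback_arg w = 4 * w / (1 - w)^2"
    using one_minus_X_power_eval[of w "4 * fps_X" 2] assms
    unfolding pullback_arg_def 1 2 by auto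
qed

lemma pullback_arg_nonneg: "fps_nth pullback_arg n \<ge> 0"
proof -
  have "fps_nth (inverse (1 - fps_X :: real fps) ^ 2) k \<ge> 0" for k
    by (rule fps_power_nth_nonneg) (simp add: inverse_one_minus_X_nth)
  then show ?thesis
    unfolding pullback_arg_def by (simp add: mult.assoc)
qed

lemma fps_pullback_eval:
  fixes f :: "real fps"
  assumes f: "\<And>n. fps_nth f n \<ge> 0" "fps_conv_radius f \<ge> 1"
    and w: "0 \<le> w" "w < 3 - 2 * sqrt 2"
  shows "eval_fps (f oo pullback_arg) w = eval_fps f (4 * w / (1 - w)^2)"
    and "ereal w < fps_conv_radius (f oo pullback_arg)"
proof -
  have sums: "(\<lambda>n. fps_nth (f oo pullback_arg) n * v ^ n) sums eval_fps f (4 * v / (1 - v)^2)"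
    if v: "0 \<le> v" "v < 3 - 2 * sqrt 2" for v
  proof -
    have v1: "\<bar>v\<bar> < 1"
      using pullback_arg_less_1[OF v] v by simp
    have "ereal v < fps_conv_radius pullback_arg"
      using v1 v pullback_arg_eval(1)[OF v1] by - (rule less_le_trans[of _ 1], auto)
    moreover have "ereal (eval_fps pullback_arg v) < fps_conv_radius f"
      using pullback_arg_less_1(1)[OF v] f(2) unfolding pullback_arg_eval(2)[OF v1]
      by - (rule less_le_trans[of _ 1], auto)
    ultimately show ?thesis
      using sums_fps_compose_nonneg[OF f(1) pullback_arg_nonneg pullback_arg_0 v(1)]
        pullback_arg_eval(2)[OF v1] by simp
  qed
  show "eval_fps (f oo pullback_arg) w = eval_fps f (4 * w / (1 - w)^2)"
    using sums[OF w] by (simp add: eval_fps_def sums_iff)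
  \<comment> \<open>Convergence at a point strictly between \<open>w\<close> and
    \<open>3 - 2 sqrt 2\<close> gives the strict radius bound at \<open>w\<close>, which evaluating
    a product of series requires.\<close>
  obtain v where v: "w < v" "v < 3 - 2 * sqrt 2"
    using dense[OF w(2)] by blast
  then have "ereal (norm v) \<le> fps_conv_radius (f oo pullback_arg)"
    unfolding fps_conv_radius_def using w sums[of v] by (intro conv_radius_geI) (auto simp: sums_iff)
  then show "ereal w < fps_conv_radius (f oo pullback_arg)"
    using v w by - (rule less_le_trans[of _ "ereal (norm v)"], auto)
qed

text \<open>Covers the right-hand sides of \<open>Abar_eq\<close> (\<open>p = 4 (1+X)\<close>,
  \<open>j = 3\<close>, \<open>k = 2\<close>) and \<open>Vbar_eq\<close> (\<open>p = 2\<close>,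
  \<open>j = k = 3\<close>) at once.\<close>

lemma hypergeo_pullback_eval:
  fixes a w :: real and j k :: nat and p :: "real fps"
  assumes a: "\<And>n. a + real n \<noteq> 0" and w: "0 \<le> w" "w < 3 - 2 * sqrt 2"
    and p: "fps_conv_radius p = \<infinity>"
  shows "eval_fps (p * inverse (1 - fps_X)^j
      * ((fps_hypergeo [a, a] [1] 1 * inverse (1 - fps_X)^k) oo pullback_arg)) w
    = eval_fps p w / (1 - w)^j * hyp2F1 a a 1 (4 * w / (1 - w)^2) / (1 - 4 * w / (1 - w)^2)^k"
proof -
  define H where "H = fps_hypergeo [a, a] [1] (1 :: real)"
  define x where "x = 4 * w / (1 - w)^2"
  let ?u = "inverse (1 - fps_X) :: real fps"
  have w1: "\<bar>w\<bar> < 1" and x1: "\<bar>x\<bar> < 1"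
    using pullback_arg_less_1[OF w] w unfolding x_def by auto
  have H: "fps_conv_radius H \<ge> 1" "\<And>n. fps_nth H n \<ge> 0"
    unfolding H_def using fps_hypergeo_conv_radius[OF a a] fps_hypergeo_square_nonneg by simp_all
  have "fps_nth (?u^k) n \<ge> 0" for n
    by (rule fps_power_nth_nonneg) (simp add: inverse_one_minus_X_nth)
  then have nonneg: "fps_nth (H * ?u^k) n \<ge> 0" for n
    using H(2) by (auto simp: fps_mult_nth intro!: sum_nonneg)
  note K = fps_pullback_eval[OF nonneg one_minus_X_power_eval(1)[OF x1 H(1)] w]
  note P = one_minus_X_power_eval[OF w1, of p j]
  have "ereal (norm w) < fps_conv_radius (p * ?u^j)"
    using w1 P(1) p by - (rule less_le_trans[of _ 1], auto)
  then show ?thesis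
    using K P(2) one_minus_X_power_eval(2)[OF x1 H(1)] w p
    by (simp add: eval_fps_mult hyp2F1_def H_def x_def)
qed

text \<open>The constant term is 1 and the other terms are nonnegative. This gives the positivity of
  \<open>A z\<close> in the final computation.\<close>

lemma hyp2F1_square_pos:
  assumes "\<And>n. a + real n \<noteq> 0" "0 \<le> x" "x < 1"
  shows "hyp2F1 a a 1 x > 0"
proof -
  let ?H = "fps_hypergeo [a, a] [1] (1 :: real)"
  have "ereal (norm x) < fps_conv_radius ?H"
    using assms fps_hypergeo_conv_radius by simp
  then have "summable (\<lambda>n. fps_nth ?H n * x ^ n)"
    by (rule summable_fps)
  moreover have "fps_nth ?H n * x ^ n \<ge> 0" for n
    using assms(2) fps_hypergeo_square_nonneg[of a n] by (intro mult_nonneg_nonneg) auto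
  ultimately show ?thesis
    unfolding hyp2F1_def eval_fps_def
    by (intro suminf_pos2[where i = 0]) auto
qed

section \<open>Assembly of the formula for \<open>Iso\<close>\<close>

theorem theorem2:
  fixes z :: real
  assumes "0 \<le> z" and "z < sqrt 2 - 1"
  shows "(Iso z)^2 =
    9 * sqrt 2 / (8 * pi)
    * ((hyp2F1 (-3/2) (-3/2) 1 (4 * z^2 / (1 - z^2)^2))^2
       / (hyp2F1 (-1/2) (-1/2) 1 (4 * z^2 / (1 - z^2)^2))^3)
    * ((1 - z^2) / (1 + z^2))^3"
proof -
  define w where "w = z^2"
  define x where "x = 4 * w / (1 - w)^2"
  define F where "F = hyp2F1 (-1/2) (-1/2) 1 x"
  define G where "G = hyp2F1 (-3/2) (-3/2) 1 x"
  \<comment> \<open>Half-odd parameters never reach zero under integer shifts, so neither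
    hypergeometric series terminates.\<close>
  have half_odd: "-1/2 + real n \<noteq> 0" "-3/2 + real n \<noteq> 0" for n
  proof -
    have "2 * n \<noteq> 1" "2 * n \<noteq> 3"
      by presburger+
    then have "real (2 * n) \<noteq> 1" "real (2 * n) \<noteq> 3"
      by linarith+
    then show "-1/2 + real n \<noteq> 0" "-3/2 + real n \<noteq> 0"
      by simp_all
  qed
  have "w < (sqrt 2 - 1)^2"
    unfolding w_def using assms by (intro power_strict_mono) auto
  then have w: "0 \<le> w" "w < 3 - 2 * sqrt 2"
    by (simp_all add: w_def power2_eq_square algebra_simps)
  have x: "x < 1" "0 \<le> x" and w1: "w < 1"
    using pullback_arg_less_1[OF w] w unfolding x_def by auto
  have F: "F > 0"
    unfolding F_def by (rule hyp2F1_square_pos[OF half_odd(1) x(2,1)])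
  have poly: "fps_conv_radius (4 * (1 + fps_X) :: real fps) = \<infinity>"
    "eval_fps (4 * (1 + fps_X)) w = 4 * (1 + w)"
    using fps_conv_radius_fps_of_poly[of "[:4, 4 :: real:]"] eval_fps_of_poly[of "[:4, 4:]" w]
    by (simp_all add: fps_of_poly_pCons algebra_simps numeral_fps_const)
  define s where "s = sqrt 2 * pi^2"
  define c where "c = (1 - w)^3"
  define d where "d = 1 - x"
  have A: "A z = s * (4 * (1 + w) / c * F / d^2)"
    unfolding A_def Abar_eq w_def[symmetric] s_def c_def d_def
    by (subst hypergeo_pullback_eval[OF half_odd(1) w poly(1)]) (simp only: poly(2) F_def x_def)
  have V: "V z = s * (2 / c * G / d^3)"
    unfolding V_def Vbar_eq w_def[symmetric] s_def c_def d_def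
    by (subst hypergeo_pullback_eval[OF half_odd(2) w]) (simp_all add: G_def x_def)
  have pos: "s > 0" "c > 0" "d > 0" "1 + w > 0"
    using w w1 x by (simp_all add: s_def c_def d_def)
  \<comment> \<open>Both \<open>V^2\<close> and \<open>A^3\<close> carry \<open>d^-6\<close>, which
    cancels. One factor \<open>c\<close> and \<open>1/s\<close> survive, and the constant is
    \<open>36 * 4 / 64 = 9/4\<close>.\<close>
  have ratio: "36 * q * (s * (2 / c * G / d^3))^2 / (s * (4 * e / c * F / d^2))^3
      = 9 * q / (4 * s) * (G^2 / F^3) * (c / e^3)"
    if "s > 0" "c > 0" "d > 0" "e > 0" "F > 0" for q s c d e F G :: real
    using that by (simp add: divide_simps) algebra
  \<comment> \<open>Positivity turns the square of \<open>powr (3/2)\<close> into an ordinary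
    cube.\<close>
  have "A z > 0"
    using pos F unfolding A by simp
  then have "(A z powr (3/2))^2 = (A z)^3"
    by (simp add: powr_power)
  then have "(Iso z)^2 = 36 * pi * (V z)^2 / (A z)^3"
    by (simp add: Iso_def power_mult_distrib power_divide)
  also have "\<dots> = 9 * pi / (4 * s) * (G^2 / F^3) * (c / (1 + w)^3)"
    unfolding A V by (rule ratio[OF pos F])
  also have "9 * pi / (4 * s) = 9 * sqrt 2 / (8 * pi)"
    by (simp add: s_def field_simps power2_eq_square)
  finally show ?thesis
    unfolding c_def F_def G_def x_def w_def by (simp add: power_divide)
qed

end
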